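(* Let $\varphi:\mathbb{R}\to\mathbb{R}$ be infinitely differentiable with strictly positive second derivative. For any integer $n\geqslant 2$ put $$\sigma=\frac{2n+1}{2n+2},\qquad \mu=\frac{n}{n+1},\qquad \varkappa=\frac{1}{2n+2},$$ and for $\varepsilon>0$ and $(x,t)\in\mathbb{R}^2$ define $$V(x,t,\varepsilon)=\int_{-\infty}^{\infty}\exp\left(-\frac{2^{2n}s^{2n+2}}{n+1}+\frac{t s^2}{\varepsilon^{\mu}}-\frac{x s}{\varepsilon^{\sigma}}\right)ds,$$ $$u_{\mathrm{in}}(x,t,\varepsilon)=-2\varepsilon\,[\varphi''(0)V(x,t,\varepsilon)]^{-1}\,\frac{\partial V(x,t,\varepsilon)}{\partial x}.$$ Then in the domain $\Omega_\varepsilon=\{(x,t): |x\varepsilon^{-\varkappa}|+|t|<K\varepsilon^{\mu}\}$, where $K>0$, the function $u_{\mathrm{in}}$ is an asymptotic solution of the equation $$\frac{\partial u}{\partial t}+\frac{\partial\varphi(u)}{\partial x}=\varepsilon\frac{\partial^2u}{\partial x^2}$$ in the following sense: $$\frac{\displaystyle\frac{\partial u_{\mathrm{in}}}{\partial t}+\frac{\partial\varphi(u_{\mathrm{in}})}{\partial x}-\varepsilon\frac{\partial^2u_{\mathrm{in}}}{\partial x^2}}{\displaystyle\sup_{(x,t)\in\Omega_\varepsilon}\left\{\left|\frac{\partial u_{\mathrm{in}}}{\partial t}\right|+\left|\frac{\partial\varphi(u_{\mathrm{in}})}{\partial x}\right|+\left|\varepsilon\frac{\partial^2u_{\mathrm{in}}}{\partial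 x^2}\right|\right\}}=O\left(\varepsilon^{\varkappa}\right).$$
   Context: Here $\varepsilon>0$ is a small parameter, and the $O(\cdot)$ estimate is understood as $\varepsilon\to0$ for $(x,t)\in\Omega_\varepsilon$, with $n$, $K$ and $\varphi$ fixed. The expression $\frac{\partial\varphi(u_{\mathrm{in}})}{\partial x}$ denotes the $x$-derivative of the composite function $(x,t)\mapsto\varphi(u_{\mathrm{in}}(x,t,\varepsilon))$.
   Formalization: The formal theorem additionally assumes φ'(0)=0; without it the claim fails: for φ(u)=u+u²/2 the residual is ∂u_in/∂x, and at (0,0) the quotient stays bounded away from 0 as ε→0 (the same happens whenever φ'(0)≠0). *)

theory Defs
  imports "HOL-Analysis.Analysis"
begin

definition smooth :: "(real \<Rightarrow> real) \<Rightarrow> bool" where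
  "smooth f \<longleftrightarrow> (\<forall>k. (deriv ^^ k) f differentiable_on UNIV)"

definition sigma_exp :: "nat \<Rightarrow> real" where
  "sigma_exp n = (2 * real n + 1) / (2 * real n + 2)"

definition mu_exp :: "nat \<Rightarrow> real" where
  "mu_exp n = real n / (real n + 1)"

definition kappa_exp :: "nat \<Rightarrow> real" where
  "kappa_exp n = 1 / (2 * real n + 2)"

definition V :: "nat \<Rightarrow> real \<Rightarrow> real \<Rightarrow> real \<Rightarrow> real" where
  "V n x t \<epsilon> = (LBINT s. exp (- (2 ^ (2 * n) * s ^ (2 * n + 2) / (real n + 1))
      + t * s ^ 2 / \<epsilon> powr mu_exp n - x * s / \<epsilon> powr sigma_exp n))"

definition u_in :: "(real \<Rightarrow> real) \<Rightarrow> nat \<Rightarrow> real \<Rightarrow> real \<Rightarrow> real \<Rightarrow> real" where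
  "u_in \<phi> n x t \<epsilon> =
     - 2 * \<epsilon> * inverse ((deriv ^^ 2) \<phi> 0 * V n x t \<epsilon>) * deriv (\<lambda>y. V n y t \<epsilon>) x"

definition Omega :: "nat \<Rightarrow> real \<Rightarrow> real \<Rightarrow> (real \<times> real) set" where
  "Omega n K \<epsilon> = {(x, t). \<bar>x * \<epsilon> powr (- kappa_exp n)\<bar> + \<bar>t\<bar> < K * \<epsilon> powr mu_exp n}"

text \<open>The three terms of the equation \<open>u\<^sub>t + \<phi>(u)\<^sub>x = \<epsilon> u\<^sub>x\<^sub>x\<close>,
  for \<open>u\<close> a function of \<open>(x, t)\<close>.\<close>

definition time_term :: "(real \<Rightarrow> real \<Rightarrow> real) \<Rightarrow> real \<Rightarrow> real \<Rightarrow> real" where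
  "time_term u x t = deriv (\<lambda>\<tau>. u x \<tau>) t"

definition flux_term :: "(real \<Rightarrow> real) \<Rightarrow> (real \<Rightarrow> real \<Rightarrow> real) \<Rightarrow> real \<Rightarrow> real \<Rightarrow> real" where
  "flux_term \<phi> u x t = deriv (\<lambda>y. \<phi> (u y t)) x"

definition viscous_term :: "real \<Rightarrow> (real \<Rightarrow> real \<Rightarrow> real) \<Rightarrow> real \<Rightarrow> real \<Rightarrow> real" where
  "viscous_term \<epsilon> u x t = \<epsilon> * (deriv ^^ 2) (\<lambda>y. u y t) x"

definition residual :: "(real \<Rightarrow> real) \<Rightarrow> real \<Rightarrow> (real \<Rightarrow> real \<Rightarrow> real) \<Rightarrow> real \<Rightarrow> real \<Rightarrow> real" where
  "residual \<phi> \<epsilon> u x t = time_term u x t + flux_term \<phi> u x t - viscous_term \<epsilon> u x t"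

definition term_size ::
  "(real \<Rightarrow> real) \<Rightarrow> real \<Rightarrow> (real \<Rightarrow> real \<Rightarrow> real) \<Rightarrow> real \<Rightarrow> real \<Rightarrow> real" where
  "term_size \<phi> \<epsilon> u x t =
     \<bar>time_term u x t\<bar> + \<bar>flux_term \<phi> u x t\<bar> + \<bar>viscous_term \<epsilon> u x t\<bar>"

end

theory Submission
  imports Defs "HOL-Probability.Distributions"
begin

text \<open>
  In the stretched variables \<open>\<xi> = x / p\<close>, \<open>\<theta> = t / q\<close> with \<open>p = \<epsilon> powr sigma_exp n\<close> and
  \<open>q = \<epsilon> powr mu_exp n\<close> the integral \<open>V\<close> is a fixed function of \<open>(\<xi>, \<theta>)\<close>, and
  \<open>\<partial>V/\<partial>\<xi>\<close> and \<open>\<partial>V/\<partial>\<theta>\<close> insert a factor \<open>-s\<close> and \<open>s\<^sup>2\<close> under the integral. Hence \<open>V\<close> solves the heat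
  equation, and by the Cole--Hopf transformation \<open>u_in\<close>, a multiple of the logarithmic derivative of
  \<open>V\<close>, solves exactly the Burgers equation \<open>u\<^sub>t + c u u\<^sub>x = \<epsilon> u\<^sub>x\<^sub>x\<close>, where
  \<open>c\<close> is the second derivative of \<open>\<phi>\<close> at zero. The scales fit because \<open>\<epsilon> q = p\<^sup>2\<close>
  (lemmas \<open>profile_burgers\<close> and \<open>residual_profile\<close>).

  Consequently the residual of the full equation is \<open>(\<phi>'(u) - c u) u\<^sub>x\<close>, which is quadratic in \<open>u\<close>
  apart from the factor \<open>u\<^sub>x\<close>, since \<open>\<phi>'(0) = 0\<close>. On the domain, which is a fixed bounded set of
  \<open>(\<xi>, \<theta>)\<close>, the moments of the integrand are bounded (\<open>mean_bounded\<close>), so \<open>u\<close> has the size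
  \<open>A\<close> of a constant times \<open>\<epsilon> powr kappa_exp n\<close>. The residual is therefore \<open>O(A\<^sup>3 / p)\<close>, while the
  terms \<open>u\<^sub>t\<close>, \<open>c u u\<^sub>x\<close> and \<open>\<epsilon> u\<^sub>x\<^sub>x\<close> are \<open>O(A\<^sup>2 / p)\<close>, which is the same as \<open>O(A / q)\<close>.

  For the quotient it remains to see that the supremum of the terms really is of this order and not
  smaller. By the Burgers equation \<open>\<bar>u\<^sub>t\<bar> + \<epsilon> \<bar>u\<^sub>x\<^sub>x\<bar>\<close> is at least \<open>c \<bar>u u\<^sub>x\<bar>\<close>, and in stretched
  variables this is nonzero at some point \<open>(\<xi>, 0)\<close> close to the origin
  (\<open>advection_nonzero_near_origin\<close>).
\<close>

section \<open>Exponential integrals depending on a parameter\<close>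

text \<open>The second-order Taylor error in a form that stays integrable: \<open>exp z - 1\<close> lies between
  \<open>z\<close> and \<open>z * exp z\<close>, so the error is at most \<open>z * (exp z - 1)\<close>.\<close>
lemma abs_exp_minus_linear_le: "\<bar>exp z - 1 - z\<bar> \<le> z\<^sup>2 * exp \<bar>z\<bar>" for z :: real
proof -
  have lo: "1 + z \<le> exp z" by (rule exp_ge_add_one_self)
  have "1 - z \<le> exp (- z)" using exp_ge_add_one_self[of "- z"] by simp
  then have "(1 - z) * exp z \<le> exp (- z) * exp z" by (intro mult_right_mono) auto
  then have up: "exp z - 1 \<le> z * exp z" by (simp add: exp_minus algebra_simps)
  show ?thesis
  proof (cases "z \<ge> 0")
    case True
    then have "z * (exp z - 1) \<le> z * (z * exp z)" using up by (intro mult_left_mono)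
    then show ?thesis using True lo up by (simp add: power2_eq_square algebra_simps)
  next
    case False
    then have "(- z) * (1 - exp z) \<le> (- z) * (- z)" using lo by (intro mult_left_mono) linarith+
    moreover have "z * z * 1 \<le> z * z * exp \<bar>z\<bar>" by (intro mult_left_mono) auto
    ultimately show ?thesis using lo up by (simp add: power2_eq_square algebra_simps)
  qed
qed

text \<open>Differentiation under the integral sign for a parameter that enters only through
  \<open>exp (q * b s)\<close>. The difference quotient differs from the claimed derivative by at most
  \<open>\<bar>h\<bar>\<close> times the integral in \<open>int2\<close> as long as \<open>\<bar>h\<bar> \<le> 1\<close>; the extra
  \<open>\<bar>b s\<bar>\<close> in that exponent pays for the displacement \<open>h\<close>.\<close>
lemma has_real_derivative_integral_exp:
  fixes g b :: "'a \<Rightarrow> real"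
  assumes int0: "\<And>q. integrable M (\<lambda>s. g s * exp (q * b s))"
    and int1: "integrable M (\<lambda>s. g s * b s * exp (p * b s))"
    and int2: "integrable M (\<lambda>s. \<bar>g s\<bar> * (b s)\<^sup>2 * exp (p * b s + \<bar>b s\<bar>))"
  shows "((\<lambda>q. LINT s|M. g s * exp (q * b s)) has_real_derivative
           (LINT s|M. g s * b s * exp (p * b s))) (at p)"
proof -
  define F where "F q = (LINT s|M. g s * exp (q * b s))" for q
  define D where "D = (LINT s|M. g s * b s * exp (p * b s))"
  define C where "C = (LINT s|M. \<bar>g s\<bar> * (b s)\<^sup>2 * exp (p * b s + \<bar>b s\<bar>))"
  have main: "\<bar>F (p + h) - F p - h * D\<bar> \<le> h\<^sup>2 * C" if h: "\<bar>h\<bar> \<le> 1" for h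
  proof -
    let ?r = "\<lambda>s. g s * exp ((p + h) * b s) - g s * exp (p * b s) - h * (g s * b s * exp (p * b s))"
    have ir: "integrable M ?r" using int0 int1 by simp
    have "\<bar>F (p + h) - F p - h * D\<bar> = \<bar>LINT s|M. ?r s\<bar>"
      unfolding F_def D_def using int0 int1 by simp
    also have "\<dots> \<le> (LINT s|M. \<bar>?r s\<bar>)" by (rule integral_abs_bound)
    also have "\<dots> \<le> (LINT s|M. h\<^sup>2 * (\<bar>g s\<bar> * (b s)\<^sup>2 * exp (p * b s + \<bar>b s\<bar>)))"
    proof (rule integral_mono)
      fix s
      have "?r s = g s * exp (p * b s) * (exp (h * b s) - 1 - h * b s)"
        unfolding distrib_right exp_add by (simp only: right_diff_distrib mult_ac mult_1_right)
      then have "\<bar>?r s\<bar> = \<bar>g s\<bar> * exp (p * b s) * \<bar>exp (h * b s) - 1 - h * b s\<bar>"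
        by (simp add: abs_mult)
      also have "\<dots> \<le> \<bar>g s\<bar> * exp (p * b s) * ((h * b s)\<^sup>2 * exp \<bar>b s\<bar>)"
      proof (intro mult_left_mono)
        have "\<bar>h * b s\<bar> \<le> \<bar>b s\<bar>" using h by (simp add: abs_mult mult_left_le_one_le)
        then have "(h * b s)\<^sup>2 * exp \<bar>h * b s\<bar> \<le> (h * b s)\<^sup>2 * exp \<bar>b s\<bar>"
          by (intro mult_left_mono) auto
        then show "\<bar>exp (h * b s) - 1 - h * b s\<bar> \<le> (h * b s)\<^sup>2 * exp \<bar>b s\<bar>"
          using abs_exp_minus_linear_le[of "h * b s"] by linarith
      qed auto
      also have "\<dots> = h\<^sup>2 * (\<bar>g s\<bar> * (b s)\<^sup>2 * exp (p * b s + \<bar>b s\<bar>))"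
        unfolding exp_add power_mult_distrib by (simp only: mult_ac)
      finally show "\<bar>?r s\<bar> \<le> h\<^sup>2 * (\<bar>g s\<bar> * (b s)\<^sup>2 * exp (p * b s + \<bar>b s\<bar>))" .
    qed (use ir int2 in auto)
    also have "\<dots> = h\<^sup>2 * C" unfolding C_def by simp
    finally show ?thesis .
  qed
  have "((\<lambda>h. (F (p + h) - F p) / h - D) \<longlongrightarrow> 0) (at 0)"
  proof (rule Lim_null_comparison)
    show "\<forall>\<^sub>F h in at 0. norm ((F (p + h) - F p) / h - D) \<le> \<bar>h\<bar> * C"
      unfolding eventually_at
    proof (intro exI[of _ 1] conjI ballI impI)
      fix h :: real assume "h \<noteq> 0 \<and> dist h 0 < 1"
      then have h: "h \<noteq> 0" "\<bar>h\<bar> \<le> 1" by auto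
      have "\<bar>(F (p + h) - F p) / h - D\<bar> = \<bar>F (p + h) - F p - h * D\<bar> / \<bar>h\<bar>"
        using h by (simp add: diff_divide_distrib flip: abs_divide)
      also have "\<dots> \<le> (h\<^sup>2 * C) / \<bar>h\<bar>" using main[OF h(2)] by (intro divide_right_mono) auto
      also have "\<dots> = \<bar>h\<bar> * C" using h by (cases "h > 0") (auto simp: power2_eq_square)
      finally show "norm ((F (p + h) - F p) / h - D) \<le> \<bar>h\<bar> * C" by simp
    qed auto
    show "((\<lambda>h. \<bar>h\<bar> * C) \<longlongrightarrow> 0) (at 0)" by (auto intro!: tendsto_eq_intros)
  qed
  then show ?thesis
    unfolding DERIV_def F_def[symmetric] D_def[symmetric] by (simp add: LIM_zero_iff)
qed

text \<open>Completing the square in \<open>s\<^sup>2\<close> absorbs the lower-order terms into \<open>a * s ^ 4\<close>,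
  and a power of degree at least four dominates \<open>s ^ 4 - 1\<close>. The remaining Gaussian decay
  allows comparison with the moments of the normal distribution.\<close>
lemma even_power_dominates:
  fixes a A B s :: real
  assumes "a > 0" "n \<ge> 1"
  shows "- (a * s ^ (2 * n + 2)) + A * s\<^sup>2 + B * \<bar>s\<bar>
           \<le> (\<bar>A\<bar> + \<bar>B\<bar> + 1)\<^sup>2 / (4 * a) + a + \<bar>B\<bar> - s\<^sup>2 / 2"
proof -
  have "\<bar>s\<bar> \<le> 1 + s\<^sup>2"
    using zero_le_power2[of "\<bar>s\<bar> - 1"] zero_le_power2[of s]
    by (simp add: power2_eq_square algebra_simps; linarith)
  then have "B * \<bar>s\<bar> \<le> \<bar>B\<bar> * (1 + s\<^sup>2)"
    by (intro mult_mono) auto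
  moreover have "A * s\<^sup>2 \<le> \<bar>A\<bar> * s\<^sup>2" by (intro mult_right_mono) auto
  moreover have "s ^ 4 \<le> s ^ (2 * n + 2) + 1"
  proof (cases "\<bar>s\<bar> \<ge> 1")
    case True
    then have "\<bar>s\<bar> ^ 4 \<le> \<bar>s\<bar> ^ (2 * n + 2)" using assms by (intro power_increasing) auto
    then show ?thesis by (simp add: power_even_abs)
  next
    case False
    then have "\<bar>s\<bar> ^ 4 \<le> 1" by (intro power_le_one) auto
    moreover have "s ^ (2 * n + 2) \<ge> 0" by (intro zero_le_even_power) auto
    ultimately show ?thesis by simp
  qed
  then have "a * s ^ 4 \<le> a * (s ^ (2 * n + 2) + 1)" using assms by (intro mult_left_mono) auto
  moreover have "(\<bar>A\<bar> + \<bar>B\<bar> + 1) * s\<^sup>2 \<le> a * s ^ 4 + (\<bar>A\<bar> + \<bar>B\<bar> + 1)\<^sup>2 / (4 * a)"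
  proof -
    define D where "D = \<bar>A\<bar> + \<bar>B\<bar> + 1"
    have "0 \<le> (2 * a * s\<^sup>2 - D)\<^sup>2 / (4 * a)" using assms by simp
    also have "\<dots> = a * s ^ 4 - D * s\<^sup>2 + D\<^sup>2 / (4 * a)"
      using assms by (simp add: field_simps power2_eq_square power4_eq_xxxx)
    finally show ?thesis unfolding D_def by simp
  qed
  moreover have "0 \<le> s\<^sup>2 / 2" by simp
  ultimately show ?thesis unfolding distrib_left distrib_right by linarith
qed

lemma integrable_power_exp_even:
  fixes a A B :: real
  assumes "a > 0" "n \<ge> 1"
  shows "integrable lborel (\<lambda>s. \<bar>s\<bar> ^ k * exp (- (a * s ^ (2 * n + 2)) + A * s\<^sup>2 + B * \<bar>s\<bar>))"
proof -
  define C where "C = (\<bar>A\<bar> + \<bar>B\<bar> + 1)\<^sup>2 / (4 * a) + a + \<bar>B\<bar>"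
  have "integrable lborel (\<lambda>s. exp C * sqrt (2 * pi) * (std_normal_density s * \<bar>s\<bar> ^ k))"
    using integrable_normal_moment_abs[of 1 0 k] by simp
  then show ?thesis
  proof (rule Bochner_Integration.integrable_bound)
    show "AE s in lborel. norm (\<bar>s\<bar> ^ k * exp (- (a * s ^ (2 * n + 2)) + A * s\<^sup>2 + B * \<bar>s\<bar>))
      \<le> norm (exp C * sqrt (2 * pi) * (std_normal_density s * \<bar>s\<bar> ^ k))"
    proof (intro AE_I2)
      fix s :: real
      have "exp (- (a * s ^ (2 * n + 2)) + A * s\<^sup>2 + B * \<bar>s\<bar>) \<le> exp (C - s\<^sup>2 / 2)"
        using even_power_dominates[OF assms, of s A B] unfolding C_def by simp
      also have "\<dots> = exp C * sqrt (2 * pi) * std_normal_density s"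
        by (simp add: std_normal_density_def flip: exp_add)
      finally have "\<bar>s\<bar> ^ k * exp (- (a * s ^ (2 * n + 2)) + A * s\<^sup>2 + B * \<bar>s\<bar>)
          \<le> \<bar>s\<bar> ^ k * (exp C * sqrt (2 * pi) * std_normal_density s)"
        by (intro mult_left_mono) auto
      then show "norm (\<bar>s\<bar> ^ k * exp (- (a * s ^ (2 * n + 2)) + A * s\<^sup>2 + B * \<bar>s\<bar>))
      \<le> norm (exp C * sqrt (2 * pi) * (std_normal_density s * \<bar>s\<bar> ^ k))"
        by (simp add: abs_mult mult_ac)
    qed
  qed auto
qed

section \<open>Moments of the stretched integrand\<close>

text \<open>The integrand of \<open>V\<close> in the stretched variables \<open>\<xi> = x / \<epsilon> powr sigma_exp n\<close> and
  \<open>\<theta> = t / \<epsilon> powr mu_exp n\<close>.\<close>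
definition weight :: "nat \<Rightarrow> real \<Rightarrow> real \<Rightarrow> real \<Rightarrow> real" where
  "weight n \<xi> \<theta> s =
     exp (- (2 ^ (2 * n) * s ^ (2 * n + 2) / (real n + 1)) + \<theta> * s ^ 2 - \<xi> * s)"

definition moment :: "nat \<Rightarrow> nat \<Rightarrow> real \<Rightarrow> real \<Rightarrow> real" where
  "moment n k \<xi> \<theta> = (LBINT s. s ^ k * weight n \<xi> \<theta> s)"

definition mean :: "nat \<Rightarrow> nat \<Rightarrow> real \<Rightarrow> real \<Rightarrow> real" where
  "mean n k \<xi> \<theta> = moment n k \<xi> \<theta> / moment n 0 \<xi> \<theta>"

text \<open>The majorant has \<open>\<xi> = - B * sgn s\<close>, so that the linear term of the exponent becomes
  \<open>B * \<bar>s\<bar>\<close>: one function dominates the weights for all \<open>\<xi>\<close> with \<open>\<bar>\<xi>\<bar> \<le> B\<close> and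
  all smaller \<open>\<theta>\<close>.\<close>
lemma integrable_weight_bound:
  assumes "n \<ge> 1" and [measurable]: "f \<in> borel_measurable lborel"
    and "\<And>s. \<bar>f s\<bar> \<le> \<bar>s\<bar> ^ k * weight n (- (B * sgn s)) A s"
  shows "integrable lborel f"
proof (rule Bochner_Integration.integrable_bound)
  show "integrable lborel (\<lambda>s. \<bar>s\<bar> ^ k *
          exp (- ((2 ^ (2 * n) / (real n + 1)) * s ^ (2 * n + 2)) + A * s\<^sup>2 + B * \<bar>s\<bar>))"
    using assms by (intro integrable_power_exp_even) auto
  have "weight n (- (B * sgn s)) A s =
      exp (- ((2 ^ (2 * n) / (real n + 1)) * s ^ (2 * n + 2)) + A * s\<^sup>2 + B * \<bar>s\<bar>)" for s
    by (simp add: weight_def abs_sgn mult_ac)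
  then show "AE s in lborel. norm (f s) \<le> norm (\<bar>s\<bar> ^ k *
          exp (- ((2 ^ (2 * n) / (real n + 1)) * s ^ (2 * n + 2)) + A * s\<^sup>2 + B * \<bar>s\<bar>))"
    using assms(3) by (simp add: abs_mult)
qed auto

lemma weight_le:
  assumes "\<bar>\<xi>\<bar> \<le> B" "\<theta> \<le> A"
  shows "weight n \<xi> \<theta> s \<le> weight n (- (B * sgn s)) A s"
proof -
  have "- \<xi> * s \<le> \<bar>\<xi>\<bar> * \<bar>s\<bar>" by (metis abs_ge_self abs_minus_cancel abs_mult)
  also have "\<dots> \<le> B * \<bar>s\<bar>" using assms by (intro mult_right_mono) auto
  finally have "- \<xi> * s \<le> B * sgn s * s" by (simp add: abs_sgn mult_ac)
  moreover have "\<theta> * s\<^sup>2 \<le> A * s\<^sup>2" using assms by (intro mult_right_mono) auto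
  ultimately show ?thesis unfolding weight_def by simp
qed

lemma weight_measurable [measurable]: "weight n \<xi> \<theta> \<in> borel_measurable borel"
  unfolding weight_def by measurable

lemma weight_pos [simp]: "weight n \<xi> \<theta> s > 0" "weight n \<xi> \<theta> s \<ge> 0"
  by (simp_all add: weight_def)

lemma integrable_moment:
  assumes "n \<ge> 1"
  shows "integrable lborel (\<lambda>s. s ^ k * weight n \<xi> \<theta> s)"
  by (rule integrable_weight_bound[OF assms, of _ k "\<bar>\<xi>\<bar>" \<theta>])
     (auto simp: abs_mult power_abs intro!: mult_left_mono weight_le)

lemma integrable_abs_moment:
  assumes "n \<ge> 1"
  shows "integrable lborel (\<lambda>s. \<bar>s\<bar> ^ k * weight n (- (B * sgn s)) A s)"
  by (rule integrable_weight_bound[OF assms, of _ k B A])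
     (auto simp: abs_mult power_abs weight_def)

lemma abs_moment_le:
  assumes "n \<ge> 1" "\<bar>\<xi>\<bar> \<le> B" "\<theta> \<le> A"
  shows "\<bar>moment n k \<xi> \<theta>\<bar> \<le> (LBINT s. \<bar>s\<bar> ^ k * weight n (- (B * sgn s)) A s)"
proof -
  have "\<bar>moment n k \<xi> \<theta>\<bar> \<le> (LBINT s. \<bar>s ^ k * weight n \<xi> \<theta> s\<bar>)"
    unfolding moment_def by (rule integral_abs_bound)
  also have "\<dots> \<le> (LBINT s. \<bar>s\<bar> ^ k * weight n (- (B * sgn s)) A s)"
    using assms
    by (intro integral_mono integrable_abs_moment integrable_abs integrable_moment)
       (auto simp: abs_mult power_abs intro!: mult_left_mono weight_le)
  finally show ?thesis .
qed

text \<open>The part of the integral over \<open>{1..2}\<close> already gives the bound, because \<open>s ^ k \<ge> 1\<close>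
  there. Uniformity in \<open>(\<xi>, \<theta>)\<close> matters for \<open>k = 0\<close>, where the moment appears as a
  denominator.\<close>
lemma even_moment_lower_bound:
  assumes "n \<ge> 1" "even k" "\<bar>\<xi>\<bar> \<le> K" "\<bar>\<theta>\<bar> \<le> K"
  shows "moment n k \<xi> \<theta> \<ge> exp (- (2 ^ (2 * n) * 2 ^ (2 * n + 2) / (real n + 1)) - 6 * K)"
    (is "_ \<ge> ?e")
proof -
  have "?e = (LBINT s. indicator {1..2::real} s * ?e)" by simp
  also have "\<dots> \<le> moment n k \<xi> \<theta>"
    unfolding moment_def
  proof (intro integral_mono integrable_moment assms)
    fix s :: real
    show "indicator {1..2} s * ?e \<le> s ^ k * weight n \<xi> \<theta> s"
    proof (cases "s \<in> {1..2}")
      case True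
      then have s: "1 \<le> s" "s \<le> 2" by auto
      have K: "K \<ge> 0" using assms by linarith
      have "2 ^ (2 * n) * s ^ (2 * n + 2) / (real n + 1)
              \<le> 2 ^ (2 * n) * 2 ^ (2 * n + 2) / (real n + 1)"
        using s by (intro divide_right_mono mult_left_mono power_mono) auto
      moreover have "\<xi> * s \<le> K * 2"
        using s assms K by (intro mult_mono) auto
      moreover have "(- \<theta>) * s\<^sup>2 \<le> K * 2\<^sup>2"
        using s assms K by (intro mult_mono power_mono) auto
      ultimately have "?e \<le> weight n \<xi> \<theta> s" unfolding weight_def by simp
      also have "\<dots> \<le> s ^ k * weight n \<xi> \<theta> s"
        using s by (simp add: one_le_power)
      finally show ?thesis using True by simp
    next
      case False
      then show ?thesis using assms by (auto simp: zero_le_even_power intro!: mult_nonneg_nonneg)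
    qed
  qed auto
  finally show ?thesis .
qed

lemma moment_even_pos:
  assumes "n \<ge> 1" "even k"
  shows "moment n k \<xi> \<theta> > 0"
  using even_moment_lower_bound[OF assms, of \<xi> "max \<bar>\<xi>\<bar> \<bar>\<theta>\<bar>" \<theta>]
  by (rule less_le_trans[rotated]) auto

lemma moment_odd_zero:
  assumes "odd k"
  shows "moment n k 0 \<theta> = 0"
proof -
  have "moment n k 0 \<theta> = (LBINT s. (- s) ^ k * weight n 0 \<theta> (- s))"
    unfolding moment_def by (subst lborel_distr_uminus[symmetric], subst integral_distr) auto
  also have "\<dots> = - moment n k 0 \<theta>"
    using assms by (simp add: moment_def weight_def power_minus_odd)
  finally show ?thesis by simp
qed

lemma moment_deriv_xi:
  assumes "n \<ge> 1"
  shows "((\<lambda>\<xi>. moment n k \<xi> \<theta>) has_real_derivative - moment n (Suc k) \<xi> \<theta>) (at \<xi>)"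
proof -
  have w: "s ^ k * weight n q \<theta> s = s ^ k * weight n 0 \<theta> s * exp (q * - s)" for q s
    by (simp add: weight_def flip: exp_add)
  have w1: "s ^ k * weight n 0 \<theta> s * - s * exp (q * - s) = - (s ^ Suc k * weight n q \<theta> s)" for q s
    unfolding power_Suc using w[of s q] by (metis (no_types) mult.assoc mult.commute mult_minus_left)
  have "((\<lambda>q. LBINT s. s ^ k * weight n 0 \<theta> s * exp (q * - s)) has_real_derivative
           (LBINT s. s ^ k * weight n 0 \<theta> s * - s * exp (\<xi> * - s))) (at \<xi>)"
  proof (rule has_real_derivative_integral_exp[where g = "\<lambda>s. s ^ k * weight n 0 \<theta> s" and b = uminus])
    show "integrable lborel (\<lambda>s. s ^ k * weight n 0 \<theta> s * exp (q * - s))" for q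
      using integrable_moment[OF assms, of k q \<theta>] by (simp only: w[symmetric])
    show "integrable lborel (\<lambda>s. s ^ k * weight n 0 \<theta> s * - s * exp (\<xi> * - s))"
      using integrable_moment[OF assms, of "Suc k" \<xi> \<theta>] by (subst w1) simp
    show "integrable lborel
        (\<lambda>s. \<bar>s ^ k * weight n 0 \<theta> s\<bar> * (- s)\<^sup>2 * exp (\<xi> * - s + \<bar>- s\<bar>))"
    proof (rule integrable_weight_bound[OF assms, of _ "k + 2" "\<bar>\<xi>\<bar> + 1" \<theta>])
      fix s :: real
      have "weight n (\<xi> - sgn s) \<theta> s = weight n 0 \<theta> s * exp (\<xi> * - s + \<bar>- s\<bar>)"
        by (simp add: weight_def abs_sgn algebra_simps flip: exp_add)
      then have "\<bar>s ^ k * weight n 0 \<theta> s\<bar> * (- s)\<^sup>2 * exp (\<xi> * - s + \<bar>- s\<bar>)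
           = \<bar>s\<bar> ^ (k + 2) * weight n (\<xi> - sgn s) \<theta> s"
        by (simp add: abs_mult power_abs power_add power2_eq_square)
      also have "\<dots> \<le> \<bar>s\<bar> ^ (k + 2) * weight n (- ((\<bar>\<xi>\<bar> + 1) * sgn s)) \<theta> s"
        by (intro mult_left_mono weight_le) (auto simp: sgn_if)
      finally show "\<bar>\<bar>s ^ k * weight n 0 \<theta> s\<bar> * (- s)\<^sup>2 * exp (\<xi> * - s + \<bar>- s\<bar>)\<bar>
        \<le> \<bar>s\<bar> ^ (k + 2) * weight n (- ((\<bar>\<xi>\<bar> + 1) * sgn s)) \<theta> s"
        by (simp add: abs_mult)
    qed measurable
  qed
  then show ?thesis unfolding w1 unfolding w[symmetric] by (simp add: moment_def)
qed

lemma moment_deriv_theta: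
  assumes "n \<ge> 1"
  shows "((\<lambda>\<theta>. moment n k \<xi> \<theta>) has_real_derivative moment n (k + 2) \<xi> \<theta>) (at \<theta>)"
proof -
  have w: "s ^ k * weight n \<xi> q s = s ^ k * weight n \<xi> 0 s * exp (q * s\<^sup>2)" for q s
    by (simp add: weight_def algebra_simps flip: exp_add)
  have w1: "s ^ k * weight n \<xi> 0 s * s\<^sup>2 * exp (q * s\<^sup>2) = s ^ (k + 2) * weight n \<xi> q s" for q s
    unfolding power_add using w[of s q] by (metis (no_types) mult.assoc mult.commute)
  have "((\<lambda>q. LBINT s. s ^ k * weight n \<xi> 0 s * exp (q * s\<^sup>2)) has_real_derivative
           (LBINT s. s ^ k * weight n \<xi> 0 s * s\<^sup>2 * exp (\<theta> * s\<^sup>2))) (at \<theta>)"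
  proof (rule has_real_derivative_integral_exp[where g = "\<lambda>s. s ^ k * weight n \<xi> 0 s" and b = "\<lambda>s. s\<^sup>2"])
    show "integrable lborel (\<lambda>s. s ^ k * weight n \<xi> 0 s * exp (q * s\<^sup>2))" for q
      using integrable_moment[OF assms, of k \<xi> q] by (simp only: w[symmetric])
    show "integrable lborel (\<lambda>s. s ^ k * weight n \<xi> 0 s * s\<^sup>2 * exp (\<theta> * s\<^sup>2))"
      using integrable_moment[OF assms, of "k + 2" \<xi> \<theta>] by (simp only: w1)
    show "integrable lborel
        (\<lambda>s. \<bar>s ^ k * weight n \<xi> 0 s\<bar> * (s\<^sup>2)\<^sup>2 * exp (\<theta> * s\<^sup>2 + \<bar>s\<^sup>2\<bar>))"
    proof (rule integrable_weight_bound[OF assms, of _ "k + 4" "\<bar>\<xi>\<bar>" "\<theta> + 1"])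
      fix s :: real
      have "\<bar>s ^ k * weight n \<xi> 0 s\<bar> * (s\<^sup>2)\<^sup>2 * exp (\<theta> * s\<^sup>2 + \<bar>s\<^sup>2\<bar>)
           = \<bar>s\<bar> ^ (k + 4) * weight n \<xi> (\<theta> + 1) s"
        by (simp add: weight_def abs_mult power_abs power_add algebra_simps flip: exp_add power_mult)
      also have "\<dots> \<le> \<bar>s\<bar> ^ (k + 4) * weight n (- (\<bar>\<xi>\<bar> * sgn s)) (\<theta> + 1) s"
        by (intro mult_left_mono weight_le) auto
      finally show "\<bar>\<bar>s ^ k * weight n \<xi> 0 s\<bar> * (s\<^sup>2)\<^sup>2 * exp (\<theta> * s\<^sup>2 + \<bar>s\<^sup>2\<bar>)\<bar>
        \<le> \<bar>s\<bar> ^ (k + 4) * weight n (- (\<bar>\<xi>\<bar> * sgn s)) (\<theta> + 1) s"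
        by (simp add: abs_mult)
    qed measurable
  qed
  then show ?thesis unfolding w1 unfolding w[symmetric] by (simp add: moment_def)
qed

lemma mean_0 [simp]: "n \<ge> 1 \<Longrightarrow> mean n 0 \<xi> \<theta> = 1"
  using moment_even_pos[of n 0 \<xi> \<theta>] by (simp add: mean_def)

text \<open>These two formulas are the only facts about the integral that the differential
  equation uses. They say that the normalized moments change by covariances under the
  probability density proportional to the weight: minus the covariance of
  \<open>s ^ k\<close> with \<open>s\<close> in \<open>\<xi>\<close>, and its covariance with \<open>s\<^sup>2\<close> in \<open>\<theta>\<close>.\<close>
lemma mean_deriv_xi:
  assumes "n \<ge> 1"
  shows "((\<lambda>\<xi>. mean n k \<xi> \<theta>) has_real_derivative
           mean n k \<xi> \<theta> * mean n 1 \<xi> \<theta> - mean n (Suc k) \<xi> \<theta>) (at \<xi>)"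
  unfolding mean_def using moment_even_pos[OF assms, of 0 \<xi> \<theta>]
  by (auto intro!: derivative_eq_intros moment_deriv_xi assms simp: field_simps)

lemma mean_deriv_theta:
  assumes "n \<ge> 1"
  shows "((\<lambda>\<theta>. mean n k \<xi> \<theta>) has_real_derivative
           mean n (k + 2) \<xi> \<theta> - mean n k \<xi> \<theta> * mean n 2 \<xi> \<theta>) (at \<theta>)"
  unfolding mean_def using moment_even_pos[OF assms, of 0 \<xi> \<theta>]
  by (auto intro!: derivative_eq_intros moment_deriv_theta[OF assms, simplified] assms simp: field_simps numeral_2_eq_2)

lemma mean_bounded:
  assumes "n \<ge> 1"
  obtains B where "\<And>k \<xi> \<theta>. k \<le> 3 \<Longrightarrow> \<bar>\<xi>\<bar> \<le> K \<Longrightarrow> \<bar>\<theta>\<bar> \<le> K \<Longrightarrow> \<bar>mean n k \<xi> \<theta>\<bar> \<le> B"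
proof -
  define e where "e = exp (- (2 ^ (2 * n) * 2 ^ (2 * n + 2) / (real n + 1)) - 6 * K)"
  define I where "I k = (LBINT s. \<bar>s\<bar> ^ k * weight n (- (K * sgn s)) K s)" for k :: nat
  have "\<bar>mean n k \<xi> \<theta>\<bar> \<le> Max ((\<lambda>k. I k / e) ` {..3})"
    if "k \<le> 3" "\<bar>\<xi>\<bar> \<le> K" "\<bar>\<theta>\<bar> \<le> K" for k \<xi> \<theta>
  proof -
    have "\<bar>moment n k \<xi> \<theta>\<bar> \<le> I k"
      unfolding I_def using that assms by (intro abs_moment_le) auto
    moreover have "e \<le> moment n 0 \<xi> \<theta>"
      unfolding e_def using that assms by (intro even_moment_lower_bound) auto
    moreover have "e > 0" by (simp add: e_def)
    ultimately have "\<bar>mean n k \<xi> \<theta>\<bar> \<le> I k / e"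
      by (simp add: mean_def abs_divide) (intro frac_le, auto)
    also have "\<dots> \<le> Max ((\<lambda>k. I k / e) ` {..3})" using that by (intro Max_ge) auto
    finally show ?thesis .
  qed
  then show ?thesis using that by blast
qed

text \<open>The expression is the advection term \<open>m\<^sub>1 * \<partial>m\<^sub>1/\<partial>\<xi>\<close> of the mean \<open>m\<^sub>1\<close>. At the origin
  \<open>m\<^sub>1\<close> vanishes by symmetry, so the derivative in \<open>\<xi>\<close> of this term is the square of the second
  moment there, hence positive. All three terms of the equation vanish at the origin itself, which
  is why a nearby point has to be found.\<close>
lemma advection_nonzero_near_origin:
  assumes "n \<ge> 1" "K > 0"
  obtains \<xi> where "0 < \<xi>" "\<xi> < K" "mean n 1 \<xi> 0 * ((mean n 1 \<xi> 0)\<^sup>2 - mean n 2 \<xi> 0) > 0"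
proof -
  define P where "P \<xi> = mean n 1 \<xi> 0 * ((mean n 1 \<xi> 0)\<^sup>2 - mean n 2 \<xi> 0)" for \<xi>
  have m1: "mean n 1 0 0 = 0" using moment_odd_zero[of 1 n 0] by (simp add: mean_def)
  have m2: "mean n 2 0 0 > 0"
    using moment_even_pos[OF assms(1), of _ 0 0] by (simp add: mean_def)
  have "(P has_real_derivative (mean n 2 0 0)\<^sup>2) (at 0)"
    unfolding P_def
    by (rule derivative_eq_intros mean_deriv_xi assms refl)+
       (simp add: m1[simplified] power2_eq_square numeral_2_eq_2)
  from DERIV_pos_inc_right[OF this] m2 obtain d
    where "d > 0" and d: "\<And>h. h > 0 \<Longrightarrow> h < d \<Longrightarrow> P 0 < P (0 + h)" by auto
  moreover have "P 0 = 0" by (simp add: P_def m1[simplified])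
  ultimately show thesis
    using that[of "min d K / 2"] assms d[of "min d K / 2"] by (auto simp: P_def)
qed

section \<open>The inner solution and the Burgers equation\<close>

text \<open>The inner solution in unscaled coordinates: amplitude \<open>A\<close>, length scale \<open>p\<close> and time
  scale \<open>q\<close>. Keeping the three scales as independent parameters separates the calculus from the
  powers of \<open>\<epsilon>\<close>.\<close>
definition profile :: "nat \<Rightarrow> real \<Rightarrow> real \<Rightarrow> real \<Rightarrow> real \<Rightarrow> real \<Rightarrow> real" where
  "profile n A p q x t = A * mean n 1 (x / p) (t / q)"

lemma u_in_eq_profile:
  assumes "n \<ge> 1"
  shows "u_in \<phi> n x t \<epsilon> =
    profile n (2 * \<epsilon> / ((deriv ^^ 2) \<phi> 0 * \<epsilon> powr sigma_exp n)) (\<epsilon> powr sigma_exp n) (\<epsilon> powr mu_exp n) x t"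
proof -
  define p q where "p = \<epsilon> powr sigma_exp n" and "q = \<epsilon> powr mu_exp n"
  have V: "V n x t \<epsilon> = moment n 0 (x / p) (t / q)" for x t
    by (simp add: V_def moment_def weight_def p_def q_def)
  have "((\<lambda>y. moment n 0 (y / p) (t / q)) has_real_derivative
           - moment n (Suc 0) (x / p) (t / q) * (1 / p)) (at x)"
    by (rule DERIV_chain2[where f = "\<lambda>\<xi>. moment n 0 \<xi> (t / q)", OF moment_deriv_xi[OF assms]])
       (cases "p = 0"; auto intro!: derivative_eq_intros)
  then have "deriv (\<lambda>y. V n y t \<epsilon>) x = - moment n (Suc 0) (x / p) (t / q) * (1 / p)"
    unfolding V by (rule DERIV_imp_deriv)
  then show ?thesis
    unfolding u_in_def V p_def[symmetric] q_def[symmetric] profile_def mean_def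
    by (simp add: divide_inverse)
qed

lemma profile_deriv_x:
  assumes "n \<ge> 1" "p \<noteq> 0"
  shows "((\<lambda>y. profile n A p q y t) has_real_derivative
           A / p * ((mean n 1 (x / p) (t / q))\<^sup>2 - mean n 2 (x / p) (t / q))) (at x)"
proof -
  have "((\<lambda>y. mean n 1 (y / p) (t / q)) has_real_derivative
          (mean n 1 (x / p) (t / q) * mean n 1 (x / p) (t / q) - mean n (Suc 1) (x / p) (t / q)) * (1 / p)) (at x)"
    by (rule DERIV_chain2[where f = "\<lambda>\<xi>. mean n 1 \<xi> (t / q)", OF mean_deriv_xi[OF assms(1)]])
       (use assms in \<open>auto intro!: derivative_eq_intros\<close>)
  from DERIV_cmult[OF this, of A] show ?thesis
    by (simp add: profile_def power2_eq_square numeral_2_eq_2)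
qed

lemma profile_deriv_xx:
  assumes "n \<ge> 1" "p \<noteq> 0"
  shows "((\<lambda>y. A / p * ((mean n 1 (y / p) (t / q))\<^sup>2 - mean n 2 (y / p) (t / q))) has_real_derivative
           A / p\<^sup>2 * (2 * mean n 1 (x / p) (t / q) ^ 3
             - 3 * mean n 1 (x / p) (t / q) * mean n 2 (x / p) (t / q) + mean n 3 (x / p) (t / q))) (at x)"
proof -
  let ?m = "\<lambda>k. mean n k (x / p) (t / q)"
  have m: "((\<lambda>y. mean n k (y / p) (t / q)) has_real_derivative (?m k * ?m 1 - ?m (Suc k)) * (1 / p)) (at x)" for k
    by (rule DERIV_chain2[where f = "\<lambda>\<xi>. mean n k \<xi> (t / q)", OF mean_deriv_xi[OF assms(1)]])
       (use assms in \<open>auto intro!: derivative_eq_intros\<close>)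
  have "((\<lambda>y. A / p * (mean n 1 (y / p) (t / q) * mean n 1 (y / p) (t / q) - mean n 2 (y / p) (t / q)))
     has_real_derivative
       A / p * ((?m 1 * ?m 1 - ?m (Suc 1)) * (1 / p) * ?m 1 + (?m 1 * ?m 1 - ?m (Suc 1)) * (1 / p) * ?m 1
         - (?m 2 * ?m 1 - ?m (Suc 2)) * (1 / p))) (at x)"
    by (intro DERIV_cmult DERIV_diff DERIV_mult m)
  moreover have "A / p * ((?m 1 * ?m 1 - ?m (Suc 1)) * (1 / p) * ?m 1 + (?m 1 * ?m 1 - ?m (Suc 1)) * (1 / p) * ?m 1
         - (?m 2 * ?m 1 - ?m (Suc 2)) * (1 / p))
      = A / p\<^sup>2 * (2 * ?m 1 ^ 3 - 3 * ?m 1 * ?m 2 + ?m 3)"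
    using assms by (simp add: field_simps power2_eq_square power3_eq_cube numeral_2_eq_2 numeral_3_eq_3)
  ultimately show ?thesis by (simp add: power2_eq_square)
qed

lemma time_term_profile:
  assumes "n \<ge> 1" "q \<noteq> 0"
  shows "time_term (profile n A p q) x t =
    A / q * (mean n 3 (x / p) (t / q) - mean n 1 (x / p) (t / q) * mean n 2 (x / p) (t / q))"
proof -
  have "((\<lambda>\<tau>. mean n 1 (x / p) (\<tau> / q)) has_real_derivative
          (mean n (1 + 2) (x / p) (t / q) - mean n 1 (x / p) (t / q) * mean n 2 (x / p) (t / q)) * (1 / q)) (at t)"
    by (rule DERIV_chain2[where f = "\<lambda>\<theta>. mean n 1 (x / p) \<theta>", OF mean_deriv_theta[OF assms(1)]])
       (use assms in \<open>auto intro!: derivative_eq_intros\<close>)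
  from DERIV_imp_deriv[OF DERIV_cmult[OF this, of A]] show ?thesis
    by (simp add: time_term_def profile_def eval_nat_numeral)
qed

lemma flux_term_profile:
  assumes "n \<ge> 1" "p \<noteq> 0" and "\<And>y. \<phi> field_differentiable at y"
  shows "flux_term \<phi> (profile n A p q) x t = deriv \<phi> (profile n A p q x t) *
    (A / p * ((mean n 1 (x / p) (t / q))\<^sup>2 - mean n 2 (x / p) (t / q)))"
proof -
  have "(\<phi> has_real_derivative deriv \<phi> (profile n A p q x t)) (at (profile n A p q x t))"
    using assms(3) by (simp add: field_differentiable_derivI)
  from DERIV_imp_deriv[OF DERIV_chain2[OF this profile_deriv_x[OF assms(1,2)]]]
  show ?thesis by (simp add: flux_term_def)
qed

lemma viscous_term_profile:
  assumes "n \<ge> 1" "p \<noteq> 0"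
  shows "viscous_term \<epsilon> (profile n A p q) x t = \<epsilon> * (A / p\<^sup>2 *
    (2 * mean n 1 (x / p) (t / q) ^ 3
       - 3 * mean n 1 (x / p) (t / q) * mean n 2 (x / p) (t / q) + mean n 3 (x / p) (t / q)))"
proof -
  have "deriv (\<lambda>y. profile n A p q y t)
      = (\<lambda>y. A / p * ((mean n 1 (y / p) (t / q))\<^sup>2 - mean n 2 (y / p) (t / q)))"
    using profile_deriv_x[OF assms] by (intro ext DERIV_imp_deriv)
  then show ?thesis
    using DERIV_imp_deriv[OF profile_deriv_xx[OF assms]]
    by (simp add: viscous_term_def numeral_2_eq_2)
qed

text \<open>The Cole--Hopf identity: the mean \<open>m\<^sub>1\<close> satisfies
  \<open>\<partial>m\<^sub>1/\<partial>\<theta> - \<partial>\<^sup>2m\<^sub>1/\<partial>\<xi>\<^sup>2 = - 2 m\<^sub>1 \<partial>m\<^sub>1/\<partial>\<xi>\<close> exactly, because the integral solves the heat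
  equation in \<open>(\<xi>, \<theta>)\<close>. The hypothesis \<open>\<epsilon> * q = p\<^sup>2\<close> is the parabolic scaling under which
  this becomes a statement about \<open>\<epsilon>\<close>-viscosity.\<close>
lemma profile_burgers:
  assumes "n \<ge> 1" "p > 0" "q > 0" "\<epsilon> * q = p\<^sup>2"
  shows "time_term (profile n A p q) x t - viscous_term \<epsilon> (profile n A p q) x t =
    - (2 * A / q * (mean n 1 (x / p) (t / q) * ((mean n 1 (x / p) (t / q))\<^sup>2 - mean n 2 (x / p) (t / q))))"
proof -
  have e: "\<epsilon> * (A / p\<^sup>2 * z) = A / q * z" for z
  proof -
    have "\<epsilon> / p\<^sup>2 = 1 / q" using assms(2-4) by (simp add: field_simps)
    then show ?thesis by (metis mult.commute mult.left_commute times_divide_eq_right mult_1_right)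
  qed
  define m1 m2 m3 where "m1 = mean n 1 (x / p) (t / q)" and "m2 = mean n 2 (x / p) (t / q)"
    and "m3 = mean n 3 (x / p) (t / q)"
  have "a * (m3 - m1 * m2) - a * (2 * m1 ^ 3 - 3 * m1 * m2 + m3) = - (2 * a * (m1 * (m1\<^sup>2 - m2)))" for a
    by (simp add: algebra_simps power2_eq_square power3_eq_cube)
  from this[of "A / q"] show ?thesis
    unfolding time_term_profile[OF assms(1) less_imp_neq[OF assms(3), THEN not_sym]]
      viscous_term_profile[OF assms(1) less_imp_neq[OF assms(2), THEN not_sym]]
      e m1_def m2_def m3_def by simp
qed

lemma amplitude_relation:
  fixes A c p q \<epsilon> :: real
  assumes "p > 0" "\<epsilon> * q = p\<^sup>2" "A * c * p = 2 * \<epsilon>"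
  shows "c * A * q = 2 * p"
proof -
  have "p * (c * A * q) = (A * c * p) * q" by (simp only: mult_ac)
  also have "\<dots> = 2 * (\<epsilon> * q)" unfolding assms(3) by simp
  also have "\<dots> = p * (2 * p)" unfolding assms(2) by (simp add: power2_eq_square)
  finally show ?thesis using assms(1) by simp
qed

text \<open>With the amplitude fixed by \<open>A * c * p = 2 * \<epsilon>\<close>, the quadratic term in
  \<open>profile_burgers\<close> is the flux of the Burgers equation with \<open>c * u\<close> as speed. What remains of
  the equation is the nonlinearity of the true speed \<open>deriv \<phi>\<close>.\<close>
lemma residual_profile:
  assumes "n \<ge> 1" "p > 0" "q > 0" "\<epsilon> * q = p\<^sup>2" "A * c * p = 2 * \<epsilon>"
    and "\<And>y. \<phi> field_differentiable at y"
  shows "residual \<phi> \<epsilon> (profile n A p q) x t =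
    (deriv \<phi> (profile n A p q x t) - c * profile n A p q x t) *
    (A / p * ((mean n 1 (x / p) (t / q))\<^sup>2 - mean n 2 (x / p) (t / q)))"
proof -
  have "c * A * q = 2 * p" by (rule amplitude_relation[OF assms(2,4,5)])
  then have e: "2 * A / q = c * A * (A / p)"
    using assms(2,3) by (simp add: field_simps)
  have "residual \<phi> \<epsilon> (profile n A p q) x t =
     flux_term \<phi> (profile n A p q) x t + (time_term (profile n A p q) x t - viscous_term \<epsilon> (profile n A p q) x t)"
    by (simp add: residual_def)
  then show ?thesis
    unfolding profile_burgers[OF assms(1-4)] e
      flux_term_profile[OF assms(1) less_imp_neq[OF assms(2), THEN not_sym] assms(6)]
    by (simp only: profile_def algebra_simps)
qed

section \<open>Small amplitudes and the stretched domain\<close>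

lemma smooth_field_differentiable:
  assumes "smooth f"
  shows "(deriv ^^ k) f field_differentiable at y"
  using assms unfolding smooth_def
  by (metis UNIV_I differentiable_on_def field_differentiable_def real_differentiable_def)

text \<open>Taylor's formula for \<open>deriv \<phi>\<close> at zero; the condition \<open>deriv \<phi> 0 = 0\<close> removes the
  constant term, which would otherwise dominate the flux for small \<open>u\<close>.\<close>
lemma deriv_linear_approx:
  assumes "smooth \<phi>" "deriv \<phi> 0 = 0"
  obtains M where "M \<ge> 0"
    "\<And>u. \<bar>u\<bar> \<le> 1 \<Longrightarrow> \<bar>deriv \<phi> u - (deriv ^^ 2) \<phi> 0 * u\<bar> \<le> M * u\<^sup>2"
proof -
  have D: "((deriv ^^ k) \<phi> has_real_derivative (deriv ^^ Suc k) \<phi> y) (at y)" for k y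
    using smooth_field_differentiable[OF assms(1), of k y] by (simp add: field_differentiable_derivI)
  have "continuous_on {-1..1} ((deriv ^^ 3) \<phi>)"
    by (rule DERIV_continuous_on[OF has_field_derivative_at_within[OF D]])
  then have "bounded ((deriv ^^ 3) \<phi> ` {-1..1})"
    by (intro compact_imp_bounded compact_continuous_image) auto
  then obtain M where "\<forall>y\<in>{-1..1}. \<bar>(deriv ^^ 3) \<phi> y\<bar> \<le> M"
    unfolding bounded_iff by auto
  then have M: "\<bar>(deriv ^^ 3) \<phi> y\<bar> \<le> M" if "y \<in> {-1..1}" for y using that by blast
  have "\<bar>deriv \<phi> u - (deriv ^^ 2) \<phi> 0 * u\<bar> \<le> M / 2 * u\<^sup>2" if "\<bar>u\<bar> \<le> 1" for u
  proof -
    have "\<exists>y. \<bar>y\<bar> \<le> \<bar>u\<bar> \<and> deriv \<phi> u =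
        (\<Sum>m<2. (deriv ^^ Suc m) \<phi> 0 / fact m * u ^ m) + (deriv ^^ Suc 2) \<phi> y / fact 2 * u ^ 2"
      by (rule Maclaurin_all_le[where diff = "\<lambda>m. (deriv ^^ Suc m) \<phi>"]) (simp, intro allI D)
    then obtain y where "\<bar>y\<bar> \<le> \<bar>u\<bar>"
      and y: "deriv \<phi> u - (deriv ^^ 2) \<phi> 0 * u = (deriv ^^ 3) \<phi> y / 2 * u\<^sup>2"
      using assms(2) by (auto simp: numeral_2_eq_2 numeral_3_eq_3)
    then have "\<bar>(deriv ^^ 3) \<phi> y\<bar> \<le> M" using that by (intro M) auto
    then have "\<bar>(deriv ^^ 3) \<phi> y\<bar> / 2 * u\<^sup>2 \<le> M / 2 * u\<^sup>2" by (intro mult_right_mono) auto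
    then show ?thesis unfolding y by (simp add: abs_mult)
  qed
  moreover have "M \<ge> 0" using M[of 0] by simp
  ultimately show ?thesis using that[of "M / 2"] by simp
qed

text \<open>In terms of \<open>k = \<epsilon> powr kappa_exp n\<close> the scales are \<open>p = \<epsilon> / k\<close> and
  \<open>q = \<epsilon> / k\<^sup>2\<close>.\<close>
lemma exponent_relations:
  "sigma_exp n = 1 - kappa_exp n" "mu_exp n = 1 - 2 * kappa_exp n"
  by (simp_all add: sigma_exp_def mu_exp_def kappa_exp_def divide_simps)

text \<open>In the stretched coordinates the domain no longer depends on \<open>\<epsilon>\<close>, which makes
  all estimates on it uniform.\<close>
lemma Omega_iff:
  assumes "\<epsilon> > 0"
  shows "(x, t) \<in> Omega n K \<epsilon> \<longleftrightarrow> \<bar>x / \<epsilon> powr sigma_exp n\<bar> + \<bar>t / \<epsilon> powr mu_exp n\<bar> < K"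
proof -
  have p: "\<epsilon> powr sigma_exp n = \<epsilon> powr kappa_exp n * \<epsilon> powr mu_exp n"
    by (simp add: exponent_relations flip: powr_add)
  show ?thesis
    using assms by (simp add: Omega_def p powr_minus abs_mult field_simps)
qed

section \<open>The asymptotic estimate\<close>

theorem theorem2:
  fixes \<phi> :: "real \<Rightarrow> real" and n :: nat and K :: real
  assumes "smooth \<phi>"
    and "\<And>y. (deriv ^^ 2) \<phi> y > 0"
    and "deriv \<phi> 0 = 0"
    and "n \<ge> 2"
    and "K > 0"
  shows "\<exists>C. \<forall>\<^sub>F \<epsilon> in at_right 0. \<forall>(x, t)\<in>Omega n K \<epsilon>.
           \<bar>residual \<phi> \<epsilon> (\<lambda>y \<tau>. u_in \<phi> n y \<tau> \<epsilon>) x t /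
             (SUP (y, \<tau>)\<in>Omega n K \<epsilon>. term_size \<phi> \<epsilon> (\<lambda>y \<tau>. u_in \<phi> n y \<tau> \<epsilon>) y \<tau>)\<bar>
           \<le> C * \<epsilon> powr kappa_exp n"
proof -
  have n: "n \<ge> 1" using assms by simp
  have diff: "\<phi> field_differentiable at y" for y
    using smooth_field_differentiable[OF assms(1), of 0 y] by simp
  define c where "c = (deriv ^^ 2) \<phi> 0"
  have c: "c > 0" using assms by (simp add: c_def)
  obtain M where M: "M \<ge> 0" "\<And>u. \<bar>u\<bar> \<le> 1 \<Longrightarrow> \<bar>deriv \<phi> u - c * u\<bar> \<le> M * u\<^sup>2"
    using deriv_linear_approx[OF assms(1,3)] unfolding c_def by blast
  obtain B where B: "\<And>k \<xi> \<theta>. k \<le> 3 \<Longrightarrow> \<bar>\<xi>\<bar> \<le> K \<Longrightarrow> \<bar>\<theta>\<bar> \<le> K \<Longrightarrow> \<bar>mean n k \<xi> \<theta>\<bar> \<le> B"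
    using mean_bounded[OF n] by blast
  have "B \<ge> 1" using B[of 0 0 0] n assms(5) by simp
  obtain \<xi> where \<xi>: "0 < \<xi>" "\<xi> < K" "mean n 1 \<xi> 0 * ((mean n 1 \<xi> 0)\<^sup>2 - mean n 2 \<xi> 0) > 0"
    using advection_nonzero_near_origin[OF n assms(5)] .
  define d where "d = mean n 1 \<xi> 0 * ((mean n 1 \<xi> 0)\<^sup>2 - mean n 2 \<xi> 0)"
  have d: "d > 0" using \<xi> by (simp add: d_def)
  have \<kappa>: "kappa_exp n > 0" by (simp add: kappa_exp_def)
  have "((\<lambda>\<epsilon>. \<epsilon> powr kappa_exp n) \<longlongrightarrow> 0) (at_right 0)"
    using \<kappa> by (intro tendsto_zero_powrI[where b = "kappa_exp n"])
       (auto simp: eventually_at_right_less intro!: tendsto_eq_intros eventually_at_rightI[of 0 1])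
  then have "\<forall>\<^sub>F \<epsilon> in at_right 0. \<epsilon> powr kappa_exp n < c / (2 * B)"
    using c \<open>B \<ge> 1\<close> by (intro order_tendstoD(2)) auto
  moreover have "\<forall>\<^sub>F \<epsilon>::real in at_right 0. \<epsilon> > 0" by (rule eventually_at_right_less)
  ultimately have "\<forall>\<^sub>F \<epsilon> in at_right 0. \<forall>(x, t)\<in>Omega n K \<epsilon>.
           \<bar>residual \<phi> \<epsilon> (\<lambda>y \<tau>. u_in \<phi> n y \<tau> \<epsilon>) x t /
             (SUP (y, \<tau>)\<in>Omega n K \<epsilon>. term_size \<phi> \<epsilon> (\<lambda>y \<tau>. u_in \<phi> n y \<tau> \<epsilon>) y \<tau>)\<bar>
           \<le> (2 * M * B\<^sup>2 * (B\<^sup>2 + B) / (c\<^sup>2 * d)) * \<epsilon> powr kappa_exp n"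
  proof eventually_elim
    fix \<epsilon> :: real
    assume small: "\<epsilon> powr kappa_exp n < c / (2 * B)" and \<epsilon>: "\<epsilon> > 0"
    define p q where "p = \<epsilon> powr sigma_exp n" and "q = \<epsilon> powr mu_exp n"
    define A where "A = 2 * \<epsilon> / (c * p)"
    have pq: "p > 0" "q > 0" using \<epsilon> by (simp_all add: p_def q_def)
    have \<kappa>p: "\<epsilon> powr kappa_exp n * p = \<epsilon>" and "\<epsilon> powr kappa_exp n * q = p"
      using \<epsilon> by (simp_all add: p_def q_def exponent_relations flip: powr_add)
    then have eq: "\<epsilon> * q = p\<^sup>2"
      by (metis mult.assoc mult.commute power2_eq_square)
    \<comment> \<open>The amplitude is proportional to \<open>\<epsilon> powr kappa_exp n\<close>; smallness of \<open>\<epsilon>\<close> keeps \<open>u\<close> in the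
      interval where the linear approximation of the speed is valid.\<close>
    define k where "k = \<epsilon> powr kappa_exp n"
    have k: "k > 0" "k * p = \<epsilon>" using \<epsilon> \<kappa>p by (simp_all add: k_def)
    have A_eq: "A = 2 / c * k"
      unfolding A_def k(2)[symmetric] using pq(1) by simp
    have "2 * B * k < c"
      using small \<open>B \<ge> 1\<close> unfolding k_def[symmetric] by (simp add: pos_less_divide_eq mult_ac)
    then have A: "A > 0" "A * B \<le> 1"
      using k c by (simp_all add: A_eq mult_ac)
    have Acp: "A * c * p = 2 * \<epsilon>" using c pq by (simp add: A_def)
    define u where "u = profile n A p q"
    have u: "(\<lambda>y \<tau>. u_in \<phi> n y \<tau> \<epsilon>) = u"
      by (intro ext) (simp add: u_in_eq_profile[OF n] u_def A_def c_def p_def q_def)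
    have means: "\<bar>mean n k (x / p) (t / q)\<bar> \<le> B" if "(x, t) \<in> Omega n K \<epsilon>" "k \<le> 3" for x t k
    proof (rule B[OF that(2)])
      have "\<bar>x / p\<bar> + \<bar>t / q\<bar> < K" using that(1) \<epsilon> by (simp only: Omega_iff p_def q_def)
      then show "\<bar>x / p\<bar> \<le> K" "\<bar>t / q\<bar> \<le> K" by linarith+
    qed
    have ux: "\<bar>(mean n 1 (x / p) (t / q))\<^sup>2 - mean n 2 (x / p) (t / q)\<bar> \<le> B\<^sup>2 + B"
      if "(x, t) \<in> Omega n K \<epsilon>" for x t
    proof -
      have "\<bar>mean n 1 (x / p) (t / q)\<bar> ^ 2 \<le> B\<^sup>2"
        by (intro power_mono means that) auto
      moreover have "\<bar>mean n 2 (x / p) (t / q)\<bar> \<le> B" by (intro means that) auto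
      ultimately show ?thesis
        unfolding power2_abs using zero_le_power2[of "mean n 1 (x / p) (t / q)"] by linarith
    qed
    have uB: "\<bar>u x t\<bar> \<le> A * B" if "(x, t) \<in> Omega n K \<epsilon>" for x t
      unfolding u_def profile_def using means[OF that, of 1] A by (simp add: abs_mult)
    \<comment> \<open>The single terms of the equation are of order \<open>A / q\<close>; the residual is smaller by one more
      factor \<open>A\<close>.\<close>
    have res: "\<bar>residual \<phi> \<epsilon> u x t\<bar> \<le> A / q * (2 / c * A * M * B\<^sup>2 * (B\<^sup>2 + B))"
      if xt: "(x, t) \<in> Omega n K \<epsilon>" for x t
    proof -
      let ?D = "(mean n 1 (x / p) (t / q))\<^sup>2 - mean n 2 (x / p) (t / q)"
      have "\<bar>u x t\<bar>\<^sup>2 \<le> (A * B)\<^sup>2" by (intro power_mono uB xt) auto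
      then have "(u x t)\<^sup>2 \<le> (A * B)\<^sup>2" by simp
      then have "M * (u x t)\<^sup>2 \<le> M * (A * B)\<^sup>2" using M(1) by (rule mult_left_mono)
      moreover have "\<bar>deriv \<phi> (u x t) - c * u x t\<bar> \<le> M * (u x t)\<^sup>2"
        using uB[OF xt] A by (intro M) linarith
      ultimately have "\<bar>deriv \<phi> (u x t) - c * u x t\<bar> * (A / p * \<bar>?D\<bar>)
          \<le> (M * (A * B)\<^sup>2) * (A / p * (B\<^sup>2 + B))"
        using M(1) A pq ux[OF xt] by (intro mult_mono mult_nonneg_nonneg) auto
      moreover have "residual \<phi> \<epsilon> u x t = (deriv \<phi> (u x t) - c * u x t) * (A / p * ?D)"
        unfolding u_def by (rule residual_profile[OF n pq eq Acp diff])
      ultimately have "\<bar>residual \<phi> \<epsilon> u x t\<bar> \<le> (M * (A * B)\<^sup>2) * (A / p * (B\<^sup>2 + B))"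
        using A pq by (simp add: abs_mult)
      also have "\<dots> = A / q * (A * (A * q / p) * M * B\<^sup>2 * (B\<^sup>2 + B))"
        using pq by (simp add: power2_eq_square)
      also have "A * q / p = 2 / c"
      proof -
        have "A * q * c = 2 * p" using amplitude_relation[OF pq(1) eq Acp] by (simp only: mult_ac)
        then show ?thesis using c pq by (simp add: nonzero_eq_divide_eq nonzero_divide_eq_eq)
      qed
      finally show ?thesis by (simp add: mult_ac)
    qed
    let ?T = "\<lambda>(y, \<tau>). term_size \<phi> \<epsilon> u y \<tau>"
    \<comment> \<open>A supremum that is not bounded above would be a default value, so boundedness has to be
      shown before a single point can bound it from below.\<close>
    have bdd: "bdd_above (?T ` Omega n K \<epsilon>)"
    proof (rule bdd_aboveI2)
      fix z assume z: "z \<in> Omega n K \<epsilon>"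
      obtain x t where xt: "z = (x, t)" by (cases z)
      define m where "m k = mean n k (x / p) (t / q)" for k
      have m: "\<bar>m k\<bar> \<le> B" if "k \<le> 3" for k
        using means[of x t k] z that by (simp add: xt m_def)
      define T where "T = A / q * (B + B * B)"
      define R where "R = A / q * (2 / c * A * M * B\<^sup>2 * (B\<^sup>2 + B))"
      define W where "W = \<epsilon> * (A / p\<^sup>2 * (2 * B ^ 3 + 3 * B * B + B))"
      have B0: "B \<ge> 0" using \<open>B \<ge> 1\<close> by simp
      have "\<bar>m 1 * m 2\<bar> \<le> B * B" unfolding abs_mult using m B0 by (intro mult_mono) auto
      moreover have "\<bar>m 1 ^ 3\<bar> \<le> B ^ 3" unfolding power_abs using m by (intro power_mono) auto
      ultimately have bounds: "\<bar>m 3 - m 1 * m 2\<bar> \<le> B + B * B"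
        "\<bar>2 * m 1 ^ 3 - 3 * m 1 * m 2 + m 3\<bar> \<le> 2 * B ^ 3 + 3 * B * B + B"
        using m[of 3] unfolding mult.assoc by linarith+
      have "\<bar>time_term u x t\<bar> \<le> T"
        unfolding u_def time_term_profile[OF n pq(2)[THEN less_imp_neq[THEN not_sym]]] T_def
        using bounds(1) A pq by (simp only: abs_mult m_def[symmetric]) (intro mult_mono, auto)
      moreover have "\<bar>viscous_term \<epsilon> u x t\<bar> \<le> W"
        unfolding u_def viscous_term_profile[OF n pq(1)[THEN less_imp_neq[THEN not_sym]]] W_def
        using bounds(2) A pq \<epsilon> by (simp only: abs_mult m_def[symmetric]) (intro mult_mono, auto)
      moreover have "\<bar>residual \<phi> \<epsilon> u x t\<bar> \<le> R"
        unfolding R_def using z xt by (intro res) auto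
      ultimately have "term_size \<phi> \<epsilon> u x t \<le> T + (R + T + W) + W"
        unfolding term_size_def residual_def by linarith
      then show "?T z \<le> T + (R + T + W) + W" by (simp add: xt)
    qed
    \<comment> \<open>At the point found near the origin the time and viscous terms cannot both be small, as their
      difference is the nonzero advection term.\<close>
    have "(\<xi> * p, 0) \<in> Omega n K \<epsilon>"
      using \<xi> \<epsilon> pq by (simp add: Omega_iff p_def[symmetric])
    then have "?T (\<xi> * p, 0) \<le> (SUP z\<in>Omega n K \<epsilon>. ?T z)" using bdd by (rule cSUP_upper)
    moreover have "2 * A / q * d \<le> ?T (\<xi> * p, 0)"
    proof -
      have "time_term u (\<xi> * p) 0 - viscous_term \<epsilon> u (\<xi> * p) 0 = - (2 * A / q * d)"
        unfolding u_def profile_burgers[OF n pq eq] d_def using pq by simp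
      then show ?thesis unfolding term_size_def by simp
    qed
    ultimately have sup: "2 * A / q * d \<le> (SUP z\<in>Omega n K \<epsilon>. ?T z)" by linarith
    have pos: "2 * A / q * d > 0" using A pq d by simp
    show "\<forall>(x, t)\<in>Omega n K \<epsilon>.
           \<bar>residual \<phi> \<epsilon> (\<lambda>y \<tau>. u_in \<phi> n y \<tau> \<epsilon>) x t /
             (SUP (y, \<tau>)\<in>Omega n K \<epsilon>. term_size \<phi> \<epsilon> (\<lambda>y \<tau>. u_in \<phi> n y \<tau> \<epsilon>) y \<tau>)\<bar>
           \<le> (2 * M * B\<^sup>2 * (B\<^sup>2 + B) / (c\<^sup>2 * d)) * \<epsilon> powr kappa_exp n"
      unfolding u
    proof (intro ballI, clarify)
      fix x t assume xt: "(x, t) \<in> Omega n K \<epsilon>"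
      have "\<bar>residual \<phi> \<epsilon> u x t / (SUP z\<in>Omega n K \<epsilon>. ?T z)\<bar>
          = \<bar>residual \<phi> \<epsilon> u x t\<bar> / (SUP z\<in>Omega n K \<epsilon>. ?T z)"
        using sup pos by (simp add: abs_divide)
      also have "\<dots> \<le> (A / q * (2 / c * A * M * B\<^sup>2 * (B\<^sup>2 + B))) / (2 * A / q * d)"
        using res[OF xt] sup pos by (intro frac_le) auto
      also have "\<dots> = A * (M * B\<^sup>2 * (B\<^sup>2 + B) / (c * d))"
        using A(1) pq d c by (simp add: field_simps)
      also have "\<dots> = (2 * M * B\<^sup>2 * (B\<^sup>2 + B) / (c\<^sup>2 * d)) * \<epsilon> powr kappa_exp n"
        by (simp add: A_eq k_def power2_eq_square mult_ac)
      finally show "\<bar>residual \<phi> \<epsilon> u x t / (SUP z\<in>Omega n K \<epsilon>. ?T z)\<bar>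
        \<le> (2 * M * B\<^sup>2 * (B\<^sup>2 + B) / (c\<^sup>2 * d)) * \<epsilon> powr kappa_exp n" .
    qed
  qed
  then show ?thesis by blast
qed

end
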